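(* Let $n\ge 1$, and let $f:\mathbb{R}^n\times\mathbb{T}^n\to\mathbb{R}$, $(\omega,x)\mapsto f(\omega,x)$, be a Lebesgue integrable function. Let $g:\mathbb{T}^n\to\mathbb{R}$ be a Riemann integrable (in particular, bounded) function. For $t\in\mathbb{R}$ put $$K(t)=\int_{\mathbb{R}^n}\int_{\mathbb{T}^n} f(\omega,\,x-\omega t)\,g(x)\,d^nx\,d^n\omega .$$ Then the limits of $K(t)$ as $t\to+\infty$ and as $t\to-\infty$ exist and $$\lim_{t\to\pm\infty}K(t)=\langle f\rangle\,\overline{g},$$ where $$\langle f\rangle=\int_{\mathbb{R}^n}\int_{\mathbb{T}^n} f(\omega,x)\,d^nx\,d^n\omega,\qquad \overline{g}=\frac{1}{(2\pi)^n}\int_{\mathbb{T}^n}g(x)\,d^nx .$$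
   Context: $\mathbb{T}^n=\{x=(x_1,\dots,x_n)\bmod 2\pi\}=(\mathbb{R}/2\pi\mathbb{Z})^n$, with $d^nx$ the Lebesgue measure of total mass $(2\pi)^n$; functions on $\mathbb{T}^n$ are identified with functions that are $2\pi$-periodic in each of $x_1,\dots,x_n$, and $x-\omega t$ is taken modulo $2\pi$ in each coordinate. *)

theory Defs
  imports "HOL-Analysis.Analysis"
begin

(* Functions on the torus (R / 2 pi Z)^n are functions on R^n that are 2 pi-periodic in each
   coordinate; torus integrals are taken over the fundamental cube [0, 2 pi]^n. *)

definition torus_periodic :: "(real ^ 'n \<Rightarrow> real) \<Rightarrow> bool" where
  "torus_periodic h \<longleftrightarrow> (\<forall>x i. h (x + axis i (2 * pi)) = h x)"

definition torus_cube :: "(real ^ 'n) set" where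
  "torus_cube = cbox 0 (\<chi> i. 2 * pi)"

definition torus_integral :: "(real ^ 'n \<Rightarrow> real) \<Rightarrow> real" where
  "torus_integral h = (LINT x:torus_cube|lebesgue. h x)"

(* The library's integrable_on is the Henstock-Kurzweil (gauge) notion. Riemann integrability
   requires convergence of the Riemann sums as the mesh tends to 0 uniformly. *)

definition riemann_integrable_on ::
    "('a::euclidean_space \<Rightarrow> real) \<Rightarrow> 'a set \<Rightarrow> bool" where
  "riemann_integrable_on h S \<longleftrightarrow>
     bounded (h ` S) \<and>
     (\<exists>I. \<forall>e>0. \<exists>d>0. \<forall>p. p tagged_division_of S \<and> (\<forall>(x, k)\<in>p. diameter k < d) \<longrightarrow>
        \<bar>(\<Sum>(x, k)\<in>p. measure lborel k * h x) - I\<bar> < e)"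

definition phase_mean :: "(real ^ 'n \<Rightarrow> real ^ 'n \<Rightarrow> real) \<Rightarrow> real" where
  "phase_mean f = (LINT \<omega>|lebesgue. torus_integral (\<lambda>x. f \<omega> x))"

definition torus_average :: "(real ^ 'n \<Rightarrow> real) \<Rightarrow> real" where
  "torus_average g = torus_integral g / (2 * pi) ^ CARD('n)"

(* No reduction of x - t *R omega modulo 2 pi is needed, f omega being periodic. *)

definition correlation ::
    "(real ^ 'n \<Rightarrow> real ^ 'n \<Rightarrow> real) \<Rightarrow> (real ^ 'n \<Rightarrow> real) \<Rightarrow> real \<Rightarrow> real" where
  "correlation f g t =
     (LINT \<omega>|lebesgue. torus_integral (\<lambda>x. f \<omega> (x - t *\<^sub>R \<omega>) * g x))"

end

theory Submission
  imports Defs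
begin

text \<open>
  By periodicity \<open>K(t) = \<integral>\<integral> f(\<omega>, x) g(x + t\<omega>) dx d\<omega>\<close>. For large \<open>\<bar>t\<bar>\<close>, continuity of translations in \<open>L\<^sup>1\<close>
  and boundedness of \<open>g\<close> allow \<open>f(\<omega>, x)\<close> to be replaced by \<open>f(\<omega> - s/t, x)\<close>, with an error that is uniformly
  small for \<open>s\<close> in a period cell; substituting \<open>\<omega> + s/t\<close> for \<open>\<omega>\<close> moves the shift into \<open>g(x + t\<omega> + s)\<close>.
  Averaging over \<open>s\<close> then replaces \<open>g\<close> by its mean.
\<close>

section \<open>Continuity of translations in the mean\<close>

lemma distr_lborel_translate:
  fixes v :: "'a::euclidean_space"
  shows "distr lborel borel (\<lambda>z. z + v) = lborel"
  using lborel_distr_plus[of v] by (simp add: add.commute[of _ v])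

lemma nn_integral_lborel_translate:
  fixes h :: "'a::euclidean_space \<Rightarrow> ennreal"
  assumes [measurable]: "h \<in> borel_measurable borel"
  shows "(\<integral>\<^sup>+z. h (z + v) \<partial>lborel) = (\<integral>\<^sup>+z. h z \<partial>lborel)"
proof -
  have "(\<integral>\<^sup>+z. h z \<partial>distr lborel borel (\<lambda>z. z + v)) = (\<integral>\<^sup>+z. h (z + v) \<partial>lborel)"
    by (rule nn_integral_distr) auto
  then show ?thesis
    by (simp add: distr_lborel_translate)
qed

lemma
  fixes h :: "'a::euclidean_space \<Rightarrow> real"
  assumes "integrable lborel h"
  shows integrable_lborel_translate: "integrable lborel (\<lambda>z. h (z + v))"
    and integral_lborel_translate: "(LINT z|lborel. h (z + v)) = (LINT z|lborel. h z)"
proof -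
  have [measurable]: "h \<in> borel_measurable borel"
    using assms by (auto dest: borel_measurable_integrable)
  show "integrable lborel (\<lambda>z. h (z + v))"
    using integrable_distr[of "\<lambda>z. z + v" lborel borel h] assms
    by (simp add: distr_lborel_translate)
  have "(LINT z|distr lborel borel (\<lambda>z. z + v). h z) = (LINT z|lborel. h (z + v))"
    by (rule integral_distr) auto
  then show "(LINT z|lborel. h (z + v)) = (LINT z|lborel. h z)"
    by (simp add: distr_lborel_translate)
qed

lemma AE_lborel_translate:
  fixes v :: "'a::euclidean_space"
  assumes "AE z in lborel. P z"
  shows "AE z in lborel. P (z + v)"
  using assms
  by (intro AE_distrD[where M' = borel and f = "\<lambda>z. z + v"]) (simp, unfold distr_lborel_translate)

text \<open>Phrased along sequences so that dominated convergence applies directly;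
  \<open>integral_translation_diff_less\<close> recovers the epsilon-delta form.\<close>

definition translation_continuous :: "('a::euclidean_space \<Rightarrow> real) \<Rightarrow> bool" where
  "translation_continuous h \<longleftrightarrow>
     (\<forall>v. v \<longlonglongrightarrow> 0 \<longrightarrow> (\<lambda>n. LINT z|lborel. \<bar>h (z + v n) - h z\<bar>) \<longlonglongrightarrow> 0)"

text \<open>The property is closed under L1 limits. Passing from \<open>h (z + v n)\<close> via
  \<open>k (z + v n)\<close> and \<open>k z\<close> to \<open>h z\<close> costs three errors; the
  first equals the last by translation invariance of Lebesgue measure, so each is below
  \<open>e / 3\<close> for large \<open>n\<close>.\<close>

lemma translation_continuous_approx:
  fixes h :: "'a::euclidean_space \<Rightarrow> real"
  assumes h: "integrable lborel h"
    and approx: "\<And>e. e > 0 \<Longrightarrow> \<exists>k. integrable lborel k \<and> translation_continuous k \<and>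
      (LINT z|lborel. \<bar>h z - k z\<bar>) < e"
  shows "translation_continuous h"
  unfolding translation_continuous_def
proof (intro allI impI LIMSEQ_I)
  fix v :: "nat \<Rightarrow> 'a" and e :: real
  assume v: "v \<longlonglongrightarrow> 0" and "e > 0"
  then obtain k where k: "integrable lborel k" "translation_continuous k"
    and hk: "(LINT z|lborel. \<bar>h z - k z\<bar>) < e / 3"
    using approx[of "e / 3"] by auto
  have "(\<lambda>n. LINT z|lborel. \<bar>k (z + v n) - k z\<bar>) \<longlonglongrightarrow> 0"
    using k(2) v by (simp add: translation_continuous_def)
  then obtain N where N: "\<And>n. n \<ge> N \<Longrightarrow> \<bar>LINT z|lborel. \<bar>k (z + v n) - k z\<bar>\<bar> < e / 3"
    using LIMSEQ_D[of _ 0 "e / 3"] \<open>e > 0\<close> by fastforce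
  note int = integrable_lborel_translate[OF h] integrable_lborel_translate[OF k(1)] h k(1)
  show "\<exists>no. \<forall>n\<ge>no. norm ((LINT z|lborel. \<bar>h (z + v n) - h z\<bar>) - 0) < e"
  proof (intro exI[of _ N] allI impI)
    fix n assume "n \<ge> N"
    have "(LINT z|lborel. \<bar>h (z + v n) - h z\<bar>)
        \<le> (LINT z|lborel. \<bar>h (z + v n) - k (z + v n)\<bar> + \<bar>k (z + v n) - k z\<bar> + \<bar>h z - k z\<bar>)"
      by (intro integral_mono) (use int in auto)
    also have "\<dots> = (LINT z|lborel. \<bar>h (z + v n) - k (z + v n)\<bar>)
        + (LINT z|lborel. \<bar>k (z + v n) - k z\<bar>) + (LINT z|lborel. \<bar>h z - k z\<bar>)"
      by (subst Bochner_Integration.integral_add; (intro Bochner_Integration.integrable_add)?)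
         (use int in auto)
    also have "(LINT z|lborel. \<bar>h (z + v n) - k (z + v n)\<bar>) = (LINT z|lborel. \<bar>h z - k z\<bar>)"
      using integral_lborel_translate[of "\<lambda>z. \<bar>h z - k z\<bar>"] h k(1) by auto
    finally show "norm ((LINT z|lborel. \<bar>h (z + v n) - h z\<bar>) - 0) < e"
      using hk N[OF \<open>n \<ge> N\<close>] by simp
  qed
qed

text \<open>Since \<open>1\<^sub>U\<close> is lower semicontinuous, the positive part of \<open>1\<^sub>U(z) - 1\<^sub>U(z + v)\<close> tends to
  \<open>0\<close> pointwise; the difference has integral \<open>0\<close>, so its negative part is no larger in mean.\<close>
lemma translation_continuous_open:
  fixes U :: "'a::euclidean_space set"
  assumes "open U" and "emeasure lborel U < \<infinity>"
  shows "translation_continuous (indicator U)"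
  unfolding translation_continuous_def
proof (intro allI impI)
  fix v :: "nat \<Rightarrow> 'a" assume v: "v \<longlonglongrightarrow> 0"
  let ?u = "indicator U :: 'a \<Rightarrow> real"
  have [measurable]: "U \<in> sets borel"
    using \<open>open U\<close> by simp
  have int: "integrable lborel ?u"
    using assms by simp
  note int' = integrable_lborel_translate[OF int]
  have "(\<lambda>n. LINT z|lborel. max 0 (?u z - ?u (z + v n))) \<longlonglongrightarrow> (LINT z|(lborel :: 'a measure). 0)"
  \<comment> \<open>The positive part vanishes off \<open>U\<close> and is at most 1 on it, so
    \<open>?u\<close> dominates it.\<close>
  proof (rule integral_dominated_convergence[where w = ?u])
    show "AE z in lborel. (\<lambda>n. max 0 (?u z - ?u (z + v n))) \<longlonglongrightarrow> 0"
    proof (intro AE_I2 tendsto_eventually)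
      fix z
      show "\<forall>\<^sub>F n in sequentially. max 0 (?u z - ?u (z + v n)) = 0"
      proof (cases "z \<in> U")
        case True
        have "(\<lambda>n. z + v n) \<longlonglongrightarrow> z + 0"
          by (intro tendsto_intros v)
        then have "\<forall>\<^sub>F n in sequentially. z + v n \<in> U"
          using \<open>open U\<close> True by (simp add: tendsto_def)
        then show ?thesis
          by eventually_elim simp
      qed (simp add: indicator_def)
    qed
  qed (auto simp: int split: split_indicator)
  then have "(\<lambda>n. 2 * (LINT z|lborel. max 0 (?u z - ?u (z + v n)))) \<longlonglongrightarrow> 2 * 0"
    by (intro tendsto_intros) simp
  moreover have "2 * (LINT z|lborel. max 0 (?u z - ?u (z + v n))) =
      (LINT z|lborel. \<bar>?u (z + v n) - ?u z\<bar>)" for n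
  proof -
    \<comment> \<open>Pointwise this is \<open>\<bar>a\<bar> = 2 * max 0 a - a\<close> with
      \<open>a = ?u z - ?u (z + v n)\<close>.\<close>
    have "(LINT z|lborel. \<bar>?u (z + v n) - ?u z\<bar>) =
        (LINT z|lborel. 2 * max 0 (?u z - ?u (z + v n)) - (?u z - ?u (z + v n)))"
      by (intro Bochner_Integration.integral_cong refl) (simp split: split_indicator)
    also have "\<dots> = (LINT z|lborel. 2 * max 0 (?u z - ?u (z + v n))) -
        (LINT z|lborel. ?u z - ?u (z + v n))"
      by (intro Bochner_Integration.integral_diff) (use int int' in auto)
    also have "(LINT z|lborel. ?u z - ?u (z + v n)) = 0"
      using int int' integral_lborel_translate[OF int] by (subst Bochner_Integration.integral_diff) auto
    finally show ?thesis by simp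
  qed
  ultimately show "(\<lambda>n. LINT z|lborel. \<bar>?u (z + v n) - ?u z\<bar>) \<longlonglongrightarrow> 0"
    by simp
qed

lemma translation_continuous_scale:
  fixes h :: "'a::euclidean_space \<Rightarrow> real"
  assumes "translation_continuous h"
  shows "translation_continuous (\<lambda>z. h z * c)"
  unfolding translation_continuous_def
proof (intro allI impI)
  fix v :: "nat \<Rightarrow> 'a" assume "v \<longlonglongrightarrow> 0"
  then have "(\<lambda>n. (LINT z|lborel. \<bar>h (z + v n) - h z\<bar>) * \<bar>c\<bar>) \<longlonglongrightarrow> 0 * \<bar>c\<bar>"
    using assms by (intro tendsto_intros) (auto simp: translation_continuous_def)
  then show "(\<lambda>n. LINT z|lborel. \<bar>h (z + v n) * c - h z * c\<bar>) \<longlonglongrightarrow> 0"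
    by (simp flip: left_diff_distrib add: abs_mult)
qed

lemma translation_continuous_add:
  fixes h k :: "'a::euclidean_space \<Rightarrow> real"
  assumes "integrable lborel h" "integrable lborel k"
    and "translation_continuous h" "translation_continuous k"
  shows "translation_continuous (\<lambda>z. h z + k z)"
  unfolding translation_continuous_def
proof (intro allI impI)
  fix v :: "nat \<Rightarrow> 'a" assume v: "v \<longlonglongrightarrow> 0"
  note int = assms(1,2) assms(1,2)[THEN integrable_lborel_translate]
  show "(\<lambda>n. LINT z|lborel. \<bar>h (z + v n) + k (z + v n) - (h z + k z)\<bar>) \<longlonglongrightarrow> 0"
  proof (rule tendsto_sandwich[OF _ _ tendsto_const])
    show "(\<lambda>n. (LINT z|lborel. \<bar>h (z + v n) - h z\<bar>) + (LINT z|lborel. \<bar>k (z + v n) - k z\<bar>)) \<longlonglongrightarrow> 0"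
      using assms(3,4) v by (intro tendsto_add_zero) (auto simp: translation_continuous_def)
    have "(LINT z|lborel. \<bar>h (z + v n) + k (z + v n) - (h z + k z)\<bar>) \<le>
        (LINT z|lborel. \<bar>h (z + v n) - h z\<bar> + \<bar>k (z + v n) - k z\<bar>)" for n
      by (intro integral_mono) (use int in auto)
    also have "(LINT z|lborel. \<bar>h (z + v n) - h z\<bar> + \<bar>k (z + v n) - k z\<bar>) =
        (LINT z|lborel. \<bar>h (z + v n) - h z\<bar>) + (LINT z|lborel. \<bar>k (z + v n) - k z\<bar>)" for n
      by (intro Bochner_Integration.integral_add) (use int in auto)
    finally show "\<forall>\<^sub>F n in sequentially. (LINT z|lborel. \<bar>h (z + v n) + k (z + v n) - (h z + k z)\<bar>) \<le>
        (LINT z|lborel. \<bar>h (z + v n) - h z\<bar>) + (LINT z|lborel. \<bar>k (z + v n) - k z\<bar>)"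
      by simp
  qed auto
qed

text \<open>Induction over integrable functions. An indicator is an L1 limit of indicators of open
  sets by outer regularity; sums are immediate, and dominated pointwise limits are again L1
  limits.\<close>

lemma integrable_translation_continuous:
  fixes h :: "'a::euclidean_space \<Rightarrow> real"
  assumes "integrable lborel h"
  shows "translation_continuous h"
  using assms
proof (induction rule: integrable_induct)
  case (base A c)
  have [measurable]: "A \<in> sets borel" 
    using base by simp
  have A: "integrable lborel (indicator A :: 'a \<Rightarrow> real)"
    using base by simp
  have "translation_continuous (indicator A :: 'a \<Rightarrow> real)"
  proof (rule translation_continuous_approx[OF A])
    fix e :: real assume "e > 0"
    obtain U where U: "open U" "A \<subseteq> U" "emeasure lborel (U - A) < e"
      using outer_regular_lborel[of A e] base \<open>e > 0\<close> by auto
    have [measurable]: "U \<in> sets borel"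
      using U by simp
    have "emeasure lborel U \<le> emeasure lborel A + emeasure lborel (U - A)"
      using emeasure_subadditive[of A lborel "U - A"] U(2) base(1) by (auto simp: Un_absorb1)
    also have "\<dots> < \<infinity>"
      using base U(3) by (auto simp: less_top[symmetric] top_unique)
    finally have fin: "emeasure lborel U < \<infinity>" .
    have fin': "emeasure lborel (U - A) \<noteq> \<infinity>"
      using U(3) by auto
    have "(LINT z|lborel. \<bar>indicator A z - indicator U z\<bar>) = (LINT z|lborel. indicator (U - A) z :: real)"
      using U(2) by (intro Bochner_Integration.integral_cong) (auto split: split_indicator)
    also have "\<dots> < e"
      using U(3) fin' \<open>e > 0\<close> by (simp add: emeasure_eq_ennreal_measure ennreal_less_iff)
    finally show "\<exists>k. integrable lborel k \<and> translation_continuous k \<and>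
        (LINT z|lborel. \<bar>indicator A z - k z\<bar>) < e"
      using fin U(1) by (intro exI[of _ "indicator U"] conjI translation_continuous_open) auto
  qed
  then show ?case
    using translation_continuous_scale by simp
next
  case (add f g)
  then show ?case
    by (intro translation_continuous_add)
next
  case (lim f s)
  show ?case
  proof (rule translation_continuous_approx)
    fix e :: real assume "e > 0"
    have "(\<lambda>i. LINT z|lborel. \<bar>f z - s i z\<bar>) \<longlonglongrightarrow> (LINT z|(lborel :: 'a measure). 0)"
    \<comment> \<open>The induction supplies \<open>s i\<close> bounded by twice
      \<open>\<bar>f z\<bar>\<close>, whence the factor 3.\<close>
    proof (rule integral_dominated_convergence[where w = "\<lambda>z. 3 * \<bar>f z\<bar>"])
      show "AE z in lborel. (\<lambda>i. \<bar>f z - s i z\<bar>) \<longlonglongrightarrow> 0"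
      proof (rule AE_I2)
        fix z assume "z \<in> space (lborel :: 'a measure)"
        then have "(\<lambda>i. \<bar>f z - s i z\<bar>) \<longlonglongrightarrow> \<bar>f z - f z\<bar>"
          by (intro tendsto_intros lim)
        then show "(\<lambda>i. \<bar>f z - s i z\<bar>) \<longlonglongrightarrow> 0" by simp
      qed
      show "AE z in lborel. norm \<bar>f z - s i z\<bar> \<le> 3 * \<bar>f z\<bar>" for i
      proof (rule AE_I2)
        fix z assume "z \<in> space (lborel :: 'a measure)"
        from lim(3)[OF this, of i] show "norm \<bar>f z - s i z\<bar> \<le> 3 * \<bar>f z\<bar>" by simp
      qed
    qed (use lim in auto)
    then obtain i where "\<bar>LINT z|lborel. \<bar>f z - s i z\<bar>\<bar> < e"
      using LIMSEQ_D[of _ 0 e] \<open>e > 0\<close> by fastforce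
    then show "\<exists>k. integrable lborel k \<and> translation_continuous k \<and>
        (LINT z|lborel. \<bar>f z - k z\<bar>) < e"
      using lim by (intro exI[of _ "s i"]) auto
  qed (fact lim)
qed

lemma integral_translation_diff_less:
  fixes h :: "'a::euclidean_space \<Rightarrow> real"
  assumes "integrable lborel h" and "e > 0"
  shows "\<exists>d>0. \<forall>v. norm v < d \<longrightarrow> (LINT z|lborel. \<bar>h (z + v) - h z\<bar>) < e"
proof -
  have "\<forall>\<^sub>F v in nhds 0. (LINT z|lborel. \<bar>h (z + v) - h z\<bar>) < e"
    unfolding eventually_nhds_iff_sequentially
  proof (intro allI impI)
    fix v :: "nat \<Rightarrow> 'a" assume "v \<longlonglongrightarrow> 0"
    then have "(\<lambda>n. LINT z|lborel. \<bar>h (z + v n) - h z\<bar>) \<longlonglongrightarrow> 0"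
      using integrable_translation_continuous[OF assms(1)] by (simp add: translation_continuous_def)
    then show "\<forall>\<^sub>F n in sequentially. (LINT z|lborel. \<bar>h (z + v n) - h z\<bar>) < e"
      using \<open>e > 0\<close> by (rule order_tendstoD)
  qed
  then show ?thesis
    by (simp add: eventually_nhds_metric)
qed

section \<open>Lattice translations and the period cell\<close>

definition lattice_point :: "('n \<Rightarrow> int) \<Rightarrow> real ^ 'n" where
  "lattice_point k = (\<chi> i. 2 * pi * of_int (k i))"

text \<open>Half-open, so that every orbit of the lattice meets it exactly once, which fails for the
  closed \<open>torus_cube\<close>. The two differ by a null set.\<close>

definition fund_cell :: "(real ^ 'n) set" where
  "fund_cell = {x. \<forall>i. 0 \<le> x $ i \<and> x $ i < 2 * pi}"

text \<open>Subtracting the integer parts is written as adding a lattice point, so that facts about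
  lattice translates apply as they stand.\<close>

definition torus_reduce :: "real ^ 'n \<Rightarrow> real ^ 'n" where
  "torus_reduce x = x + lattice_point (\<lambda>i. - \<lfloor>x $ i / (2 * pi)\<rfloor>)"

text \<open>A density on the whole space rather than a restricted space: measurability remains that
  of \<open>borel\<close>, while the measure is finite and lives on the cell.\<close>

definition torus_measure :: "(real ^ 'n) measure" where
  "torus_measure = density lborel (\<lambda>x. ennreal (indicator fund_cell x))"

text \<open>In each coordinate the condition is the inequality that characterises the floor of
  \<open>x $ i / (2 * pi)\<close>; hence exactly one lattice translate of \<open>x\<close> lies in
  the cell.\<close>

lemma fund_cell_shift_iff:
  "x + lattice_point k \<in> fund_cell \<longleftrightarrow> k = (\<lambda>i. - \<lfloor>x $ i / (2 * pi)\<rfloor>)"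
proof -
  have "0 \<le> x $ i + 2 * pi * of_int (k i) \<and> x $ i + 2 * pi * of_int (k i) < 2 * pi \<longleftrightarrow>
      k i = - \<lfloor>x $ i / (2 * pi)\<rfloor>" for i
  proof -
    have "0 \<le> x $ i + 2 * pi * of_int (k i) \<and> x $ i + 2 * pi * of_int (k i) < 2 * pi \<longleftrightarrow>
        of_int (- k i) \<le> x $ i / (2 * pi) \<and> x $ i / (2 * pi) < of_int (- k i) + 1"
      using pi_gt_zero by (auto simp: field_simps)
    also have "\<dots> \<longleftrightarrow> \<lfloor>x $ i / (2 * pi)\<rfloor> = - k i"
      by (simp add: floor_eq_iff)
    finally show ?thesis by linarith
  qed
  then show ?thesis
    by (simp add: fund_cell_def lattice_point_def fun_eq_iff)
qed

lemma torus_reduce_in_fund_cell: "torus_reduce x \<in> fund_cell"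
  by (simp add: torus_reduce_def fund_cell_shift_iff)

lemma torus_reduce_id: "x \<in> fund_cell \<Longrightarrow> torus_reduce x = x"
  using fund_cell_shift_iff[of x "\<lambda>_. 0"]
  by (simp add: torus_reduce_def lattice_point_def fun_eq_iff flip: zero_vec_def)

lemma torus_reduce_shift: "torus_reduce (x + lattice_point k) = torus_reduce x"
proof -
  have "\<lfloor>(x + lattice_point k) $ i / (2 * pi)\<rfloor> = \<lfloor>x $ i / (2 * pi)\<rfloor> + k i" for i
    by (simp add: lattice_point_def add_divide_distrib)
  then show ?thesis
    by (simp add: torus_reduce_def lattice_point_def vec_eq_iff algebra_simps)
qed

text \<open>Single periods are iterated to natural multiples, extended to integer multiples, and
  then added up over the coordinates.\<close>

lemma torus_periodic_lattice:
  fixes h :: "real ^ 'n \<Rightarrow> real"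
  assumes "torus_periodic h"
  shows "h (x + lattice_point k) = h x"
proof -
  have nat: "h (x + axis i (2 * pi * real m)) = h x" for x i m
  proof (induction m)
    case 0
    have "axis i 0 = (0 :: real ^ 'n)"
      by (simp add: axis_def vec_eq_iff)
    from this show ?case by (simp only: mult_zero_right of_nat_0 add_0_right)
  next
    case (Suc m)
    have "x + axis i (2 * pi * real (Suc m)) = (x + axis i (2 * pi * real m)) + axis i (2 * pi)"
      by (simp add: axis_def vec_eq_iff algebra_simps)
    then have "h (x + axis i (2 * pi * real (Suc m))) =
        h ((x + axis i (2 * pi * real m)) + axis i (2 * pi))"
      by (rule arg_cong)
    also have "\<dots> = h (x + axis i (2 * pi * real m))"
      using assms by (auto simp only: torus_periodic_def)
    finally show ?case
      using Suc by simp
  qed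
  have int: "h (x + axis i (2 * pi * of_int m)) = h x" for x i m
  proof (cases "m \<ge> 0")
    case True
    then show ?thesis using nat[of x i "nat m"] by simp
  next
    case False
    \<comment> \<open>A negative multiple is undone by a positive one, starting from the shifted
      point.\<close>
    have "x = (x + axis i (2 * pi * of_int m)) + axis i (2 * pi * real (nat (- m)))"
      using False by (simp add: axis_def vec_eq_iff)
    then show ?thesis using nat by metis
  qed
  have "h (x + (\<Sum>i\<in>I. axis i (2 * pi * of_int (k i)))) = h x" if "finite I" for I x
    using that
  proof (induction I arbitrary: x)
    case (insert i I)
    have "h (x + (\<Sum>i\<in>insert i I. axis i (2 * pi * of_int (k i)))) =
        h ((x + axis i (2 * pi * of_int (k i))) + (\<Sum>i\<in>I. axis i (2 * pi * of_int (k i))))"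
      using insert by (simp add: add.assoc)
    then show ?case
      using insert int by simp
  qed simp
  moreover have "lattice_point k = (\<Sum>i\<in>UNIV. axis i (2 * pi * of_int (k i)))"
    by (simp add: lattice_point_def vec_eq_iff axis_def if_distrib[of "\<lambda>f. f $ _"] cong: if_cong)
  ultimately show ?thesis
    by simp
qed

lemma torus_periodic_reduce: "torus_periodic h \<Longrightarrow> h (torus_reduce x) = h x"
  by (simp add: torus_reduce_def torus_periodic_lattice)

lemma torus_periodic_comp_reduce: "torus_periodic (\<lambda>x :: real ^ 'n. h (torus_reduce x))"
proof -
  have "axis i (2 * pi) = lattice_point (\<lambda>j. if j = i then 1 else 0)" for i :: 'n
    by (simp add: lattice_point_def vec_eq_iff axis_def)
  then show ?thesis
    by (simp add: torus_periodic_def torus_reduce_shift)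
qed

lemma measurable_vec_nth [measurable]: "(\<lambda>x :: real ^ 'n. x $ i) \<in> borel_measurable borel"
  by (intro borel_measurable_continuous_onI continuous_intros)

lemma fund_cell_measurable [measurable]: "fund_cell \<in> sets borel"
  unfolding fund_cell_def by measurable

lemma torus_reduce_measurable [measurable]:
  "(torus_reduce :: real ^ 'n \<Rightarrow> real ^ 'n) \<in> borel_measurable borel"
proof -
  have "(\<lambda>x. torus_reduce x \<bullet> b) \<in> borel_measurable borel" if "b \<in> Basis" for b :: "real ^ 'n"
  proof -
    from that obtain i where "b = axis i 1"
      by (auto simp: Basis_vec_def)
    then have "(\<lambda>x. torus_reduce x \<bullet> b) =
        (\<lambda>x. x $ i + 2 * pi * of_int (- \<lfloor>x $ i / (2 * pi)\<rfloor>))"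
      by (auto simp: torus_reduce_def lattice_point_def inner_axis)
    also have "\<dots> \<in> borel_measurable borel"
      by measurable
    finally show ?thesis .
  qed
  then show ?thesis
    by (simp add: borel_measurable_euclidean_space[of torus_reduce])
qed

section \<open>Lebesgue measure on the period cell and its invariance under translations\<close>

lemma sets_torus_measure [measurable_cong, simp]: "sets torus_measure = sets borel"
  by (simp add: torus_measure_def)

lemma space_torus_measure [simp]: "space torus_measure = UNIV"
  by (simp add: torus_measure_def)

text \<open>The cell lies between the open box and the closed cube, whose volumes agree.\<close>

lemma AE_in_fund_cell_iff_torus_cube:
  "AE x in lborel. (x :: real ^ 'n) \<in> torus_cube \<longleftrightarrow> x \<in> fund_cell"
proof -
  have cbox: "(torus_cube :: (real ^ 'n) set) = cbox 0 (\<chi> i. 2 * pi)"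
    and sub: "box 0 (\<chi> i. 2 * pi) \<subseteq> (fund_cell :: (real ^ 'n) set)"
      "fund_cell \<subseteq> cbox 0 (\<chi> i. 2 * pi :: real ^ 'n)"
    by (auto simp: torus_cube_def fund_cell_def mem_box_cart less_imp_le)
  have "cbox 0 (\<chi> i. 2 * pi) - box 0 (\<chi> i. 2 * pi) \<in> null_sets (lborel :: (real ^ 'n) measure)"
    by (auto simp: null_sets_def emeasure_Diff emeasure_lborel_box_eq emeasure_lborel_cbox_eq
        box_subset_cbox)
  from AE_not_in[OF this] show ?thesis
    unfolding cbox by eventually_elim (use sub in auto)
qed

lemma emeasure_torus_measure: "emeasure torus_measure (UNIV :: (real ^ 'n) set) = (2 * pi) ^ CARD('n)"
proof -
  have "emeasure torus_measure (UNIV :: (real ^ 'n) set) =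
      emeasure lborel (fund_cell :: (real ^ 'n) set)"
    by (simp add: torus_measure_def emeasure_density ennreal_indicator)
  also have "\<dots> = emeasure lborel (torus_cube :: (real ^ 'n) set)"
    using AE_in_fund_cell_iff_torus_cube
    by (intro emeasure_eq_AE) (auto simp: torus_cube_def)
  also have "\<dots> = ennreal (measure lborel (cbox 0 (\<chi> i. 2 * pi) :: (real ^ 'n) set))"
    unfolding torus_cube_def by (intro emeasure_eq_ennreal_measure) (simp add: emeasure_lborel_cbox_eq)
  also have "measure lborel (cbox 0 (\<chi> i. 2 * pi) :: (real ^ 'n) set) = (2 * pi) ^ CARD('n)"
    by (subst content_cbox_cart) (auto simp: interval_ne_empty_cart)
  finally show ?thesis
    by simp
qed

interpretation torus: finite_measure torus_measure
  by standard (simp add: emeasure_torus_measure ennreal_mult_eq_top_iff power_eq_top_ennreal)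

lemma nn_integral_torus_measure:
  "h \<in> borel_measurable borel \<Longrightarrow>
     (\<integral>\<^sup>+x. h x \<partial>torus_measure) = (\<integral>\<^sup>+x. indicator fund_cell x * h x \<partial>lborel)"
  by (simp add: torus_measure_def nn_integral_density ennreal_indicator)

lemma integral_torus_measure:
  fixes h :: "real ^ 'n \<Rightarrow> real"
  assumes "h \<in> borel_measurable borel"
  shows "(LINT x|torus_measure. h x) = (LINT x|lborel. indicator fund_cell x * h x)"
  using assms by (simp add: torus_measure_def integral_density)

text \<open>Unfolding over the lattice: the translated cell is cut along the lattice translates of
  the cell, each piece is moved back by its lattice vector, which \<open>H\<close> does not notice,
  and the pieces reassemble to the cell.\<close>

lemma nn_integral_torus_translate:
  fixes H :: "real ^ 'n \<Rightarrow> ennreal"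
  assumes [measurable]: "H \<in> borel_measurable borel"
    and per: "\<And>x k. H (x + lattice_point k) = H x"
  shows "(\<integral>\<^sup>+x. H (x + c) \<partial>torus_measure) = (\<integral>\<^sup>+x. H x \<partial>torus_measure)"
proof -
  let ?Q = "fund_cell :: (real ^ 'n) set"
  have one: "(\<integral>\<^sup>+k. indicator ?Q (y + lattice_point k) \<partial>count_space UNIV) = 1" for y
  proof -
    have "(\<integral>\<^sup>+k. indicator ?Q (y + lattice_point k) \<partial>count_space UNIV) =
        (\<integral>\<^sup>+k. indicator {\<lambda>i. - \<lfloor>y $ i / (2 * pi)\<rfloor>} k \<partial>count_space UNIV)"
      by (intro nn_integral_cong) (simp add: indicator_def fund_cell_shift_iff)
    then show ?thesis by simp
  qed
  have minus: "y - lattice_point k = y + lattice_point (\<lambda>i. - k i)" for y :: "real ^ 'n" and k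
    by (simp add: lattice_point_def vec_eq_iff)
  have one': "(\<integral>\<^sup>+k. indicator ?Q (y - lattice_point k) \<partial>count_space UNIV) = 1" for y
  proof -
    \<comment> \<open>Negation permutes the lattice, so subtracting lattice points gives the same
      count as adding them.\<close>
    have "bij (\<lambda>(k :: 'n \<Rightarrow> int) i. - k i)"
      by (rule involuntory_imp_bij) simp
    from nn_integral_bij_count_space[OF this, of "\<lambda>k. indicator ?Q (y + lattice_point k)"]
    show ?thesis
      by (simp add: minus one)
  qed
  \<comment> \<open>The factor 1 inserted here is the number of lattice translates of
    \<open>x + c\<close> in the cell.\<close>
  have "(\<integral>\<^sup>+x. H (x + c) \<partial>torus_measure) =
      (\<integral>\<^sup>+x. indicator ?Q x * H (x + c) * (\<integral>\<^sup>+k. indicator ?Q (x + c + lattice_point k) \<partial>count_space UNIV) \<partial>lborel)"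
    by (simp add: nn_integral_torus_measure one)
  also have "\<dots> = (\<integral>\<^sup>+x. \<integral>\<^sup>+k. indicator ?Q x * H (x + c) * indicator ?Q (x + c + lattice_point k) \<partial>count_space UNIV \<partial>lborel)"
    by (simp add: nn_integral_cmult)
  also have "\<dots> = (\<integral>\<^sup>+k. \<integral>\<^sup>+x. indicator ?Q x * H (x + c) * indicator ?Q (x + c + lattice_point k) \<partial>lborel \<partial>count_space UNIV)"
    by (intro nn_integral_count_space_nn_integral) auto
  also have "\<dots> = (\<integral>\<^sup>+k. \<integral>\<^sup>+y. indicator ?Q (y - c - lattice_point k) * H y * indicator ?Q y \<partial>lborel \<partial>count_space UNIV)"
  proof (rule nn_integral_cong)
    fix k :: "'n \<Rightarrow> int"
    let ?l = "lattice_point k :: real ^ 'n"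
    let ?h = "\<lambda>y. indicator ?Q (y - c - ?l) * H y * indicator ?Q y"
    \<comment> \<open>Periodicity replaces \<open>H (x + c)\<close> by
      \<open>H (x + c + ?l)\<close>, so the whole integrand is a function of
      \<open>x + (c + ?l)\<close>.\<close>
    have "indicator ?Q x * H (x + c) * indicator ?Q (x + c + ?l) = ?h (x + (c + ?l))" for x
      using per[of "x + c" k] by (simp add: add.assoc[symmetric])
    then have "(\<integral>\<^sup>+x. indicator ?Q x * H (x + c) * indicator ?Q (x + c + ?l) \<partial>lborel) =
        (\<integral>\<^sup>+x. ?h (x + (c + ?l)) \<partial>lborel)"
      by simp
    also have "\<dots> = (\<integral>\<^sup>+y. ?h y \<partial>lborel)"
      by (rule nn_integral_lborel_translate) measurable
    finally show "(\<integral>\<^sup>+x. indicator ?Q x * H (x + c) * indicator ?Q (x + c + ?l) \<partial>lborel) =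
        (\<integral>\<^sup>+y. ?h y \<partial>lborel)" .
  qed
  also have "\<dots> = (\<integral>\<^sup>+y. \<integral>\<^sup>+k. indicator ?Q (y - c - lattice_point k) * H y * indicator ?Q y \<partial>count_space UNIV \<partial>lborel)"
    by (intro nn_integral_count_space_nn_integral[symmetric]) auto
  also have "\<dots> = (\<integral>\<^sup>+y. indicator ?Q y * H y \<partial>lborel)"
  proof (rule nn_integral_cong)
    fix y
    have "(\<integral>\<^sup>+k. indicator ?Q (y - c - lattice_point k) * (H y * indicator ?Q y) \<partial>count_space UNIV) =
        H y * indicator ?Q y"
      by (subst nn_integral_multc) (simp_all add: one')
    then show "(\<integral>\<^sup>+k. indicator ?Q (y - c - lattice_point k) * H y * indicator ?Q y \<partial>count_space UNIV) =
        indicator ?Q y * H y"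
      by (simp only: ac_simps)
  qed
  finally show ?thesis
    by (simp add: nn_integral_torus_measure)
qed

text \<open>Rotations of the torus preserve its measure. In this form the fact transports Bochner
  integrals as well, without separating positive and negative parts.\<close>

lemma distr_torus_measure_translate:
  "distr torus_measure torus_measure (\<lambda>x. torus_reduce (x + c)) = torus_measure"
proof (rule measure_eqI)
  fix A assume "A \<in> sets (distr torus_measure torus_measure (\<lambda>x. torus_reduce (x + c)))"
  then have [measurable]: "A \<in> sets borel" by simp
  have "emeasure (distr torus_measure torus_measure (\<lambda>x. torus_reduce (x + c))) A =
      (\<integral>\<^sup>+x. indicator A (torus_reduce (x + c)) \<partial>torus_measure)"
    by (subst nn_integral_distr[symmetric, of _ _ torus_measure]) auto
  also have "\<dots> = (\<integral>\<^sup>+x. indicator A (torus_reduce x) \<partial>torus_measure)"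
    by (intro nn_integral_torus_translate[of "\<lambda>x. indicator A (torus_reduce x)"])
       (auto simp: torus_reduce_shift)
  also have "\<dots> = (\<integral>\<^sup>+x. indicator fund_cell x * indicator A (torus_reduce x) \<partial>lborel)"
    by (rule nn_integral_torus_measure) simp
  also have "\<dots> = (\<integral>\<^sup>+x. indicator fund_cell x * indicator A x \<partial>lborel)"
    by (intro nn_integral_cong) (auto simp: torus_reduce_id split: split_indicator)
  also have "\<dots> = (\<integral>\<^sup>+x. indicator A x \<partial>torus_measure)"
    by (rule nn_integral_torus_measure[symmetric]) simp
  finally show "emeasure (distr torus_measure torus_measure (\<lambda>x. torus_reduce (x + c))) A =
      emeasure torus_measure A"
    by simp
qed simp

lemma integral_torus_translate:
  fixes H :: "real ^ 'n \<Rightarrow> real"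
  assumes [measurable]: "H \<in> borel_measurable borel" and "torus_periodic H"
  shows "(LINT x|torus_measure. H (x + c)) = (LINT x|torus_measure. H x)"
proof -
  have "(LINT x|distr torus_measure torus_measure (\<lambda>x. torus_reduce (x + c)). H x) =
      (LINT x|torus_measure. H (torus_reduce (x + c)))"
    by (intro integral_distr) auto
  then show ?thesis
    using assms(2) by (simp add: distr_torus_measure_translate torus_periodic_reduce)
qed

section \<open>Averaging over translations\<close>

lemma integrable_mult_bounded:
  fixes f :: "'a \<Rightarrow> real" and G :: "'b \<Rightarrow> real"
  assumes f: "integrable M f" and G: "G \<in> borel_measurable N" and g: "g \<in> measurable M N"
    and bound: "\<And>x. \<bar>G x\<bar> \<le> B"
  shows "integrable M (\<lambda>z. f z * G (g z))"
proof (rule Bochner_Integration.integrable_bound[of _ "\<lambda>z. f z * B"])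
  have "\<bar>G x\<bar> \<le> \<bar>B\<bar>" for x
    using bound[of x] by linarith
  then show "AE z in M. norm (f z * G (g z)) \<le> norm (f z * B)"
    by (auto simp: abs_mult intro!: mult_left_mono)
  show "(\<lambda>z. f z * G (g z)) \<in> borel_measurable M"
    using f measurable_compose[OF g G] by (auto dest: borel_measurable_integrable)
qed (use f in simp)

text \<open>The limit for Borel data. In the application \<open>F\<close> is the phase function cut
  off to one period cell in \<open>x\<close>, so that the integral may run over the full product
  space; \<open>at_infinity\<close> treats both signs of \<open>t\<close> at once.\<close>

lemma tendsto_product_translate:
  fixes F :: "(real ^ 'n) \<times> (real ^ 'n) \<Rightarrow> real" and G :: "real ^ 'n \<Rightarrow> real"
  assumes F: "integrable lborel F"
    and G [measurable]: "G \<in> borel_measurable borel"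
    and per: "torus_periodic G" and bound: "\<And>x. \<bar>G x\<bar> \<le> B"
  shows "((\<lambda>t. LINT z|lborel. F z * G (snd z + t *\<^sub>R fst z)) \<longlongrightarrow>
           (LINT z|lborel. F z) * ((LINT x|torus_measure. G x) / (2 * pi) ^ CARD('n))) at_infinity"
    (is "(?K \<longlongrightarrow> ?L) _")
proof (rule tendstoI)
  fix e :: real assume "e > 0"
  let ?V = "(2 * pi) ^ CARD('n) :: real"
  have V: "measure torus_measure (UNIV :: (real ^ 'n) set) = ?V" "?V > 0"
    using emeasure_torus_measure[where ?'n = 'n] by (simp_all add: measure_def)
  have [measurable]: "F \<in> borel_measurable borel"
    using F by (auto dest: borel_measurable_integrable)
  have "B \<ge> 0"
    using bound[of 0] by linarith
  note bounded_mult = integrable_mult_bounded[OF _ G _ bound]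
  \<comment> \<open>Chosen so that \<open>B * d < e\<close>; the summand 1 covers
    \<open>B = 0\<close>.\<close>
  define d where "d = e / (B + 1)"
  have "d > 0"
    using \<open>e > 0\<close> \<open>B \<ge> 0\<close> by (simp add: d_def)
  obtain r where "r > 0" 
    and r: "\<And>v. norm v < r \<Longrightarrow> (LINT z|lborel. \<bar>F (z + v) - F z\<bar>) < d"
    using integral_translation_diff_less[OF F \<open>d > 0\<close>] by blast
  obtain R where R: "\<And>s :: real ^ 'n. s \<in> fund_cell \<Longrightarrow> norm s \<le> R" "R \<ge> 0"
  proof -
    have "fund_cell \<subseteq> cbox 0 (\<chi> i. 2 * pi :: real ^ 'n)"
      by (auto simp: fund_cell_def mem_box_cart less_imp_le)
    then have "bounded (fund_cell :: (real ^ 'n) set)"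
      using bounded_cbox bounded_subset by blast
    then show ?thesis
      using that unfolding bounded_pos by (blast intro: less_imp_le)
  qed
  \<comment> \<open>Beyond this threshold \<open>R / \<bar>t\<bar> < r\<close>, so the shift by
    \<open>s / t\<close> is shorter than \<open>r\<close> for every \<open>s\<close> in the
    cell.\<close>
  have "dist (?K t) ?L < e" if t: "norm t > R / r + 1" for t
  proof -
    have "R / r < \<bar>t\<bar>"
      using t by simp
    moreover have "0 \<le> R / r"
      using \<open>R \<ge> 0\<close> \<open>r > 0\<close> by simp
    ultimately have "\<bar>t\<bar> > 0"
      by linarith
    then have "R / \<bar>t\<bar> < r"
      using \<open>R / r < \<bar>t\<bar>\<close> \<open>r > 0\<close> by (simp add: pos_divide_less_eq mult.commute)
    define u :: "(real ^ 'n) \<times> (real ^ 'n) \<Rightarrow> real ^ 'n" where "u z = snd z + t *\<^sub>R fst z" for z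
    have [measurable]: "u \<in> borel_measurable borel"
      unfolding u_def by (intro borel_measurable_continuous_onI continuous_intros)
    define S where "S s = (LINT z|lborel. F z * G (u z + s))" for s
    let ?k = "LINT z|lborel. F z * G (u z)"
    have near: "\<bar>?k - S s\<bar> \<le> B * d" if s: "s \<in> fund_cell" for s
    proof -
      \<comment> \<open>Moving the frequency by \<open>- s / t\<close> changes \<open>u\<close> by
        exactly \<open>- s\<close>, which cancels the shift in \<open>S s\<close> and leaves the
        translation on \<open>F\<close> only.\<close>
      let ?v = "(- ((1 / t) *\<^sub>R s), 0) :: (real ^ 'n) \<times> (real ^ 'n)"
      have "norm ?v = norm s / \<bar>t\<bar>"
        by (simp add: norm_Pair)
      also have "\<dots> \<le> R / \<bar>t\<bar>"
        using R(1)[OF s] by (intro divide_right_mono) auto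
      finally have "norm ?v < r"
        using \<open>R / \<bar>t\<bar> < r\<close> by simp
      have int_shift: "integrable lborel (\<lambda>z. F (z + ?v))"
        by (rule integrable_lborel_translate[OF F])
      have "S s = (LINT z|lborel. F (z + ?v) * G (u (z + ?v) + s))"
        unfolding S_def
        by (rule integral_lborel_translate[symmetric]) (intro bounded_mult F; measurable)
      also have "\<dots> = (LINT z|lborel. F (z + ?v) * G (u z))"
        using \<open>\<bar>t\<bar> > 0\<close> by (simp add: u_def scaleR_diff_right)
      finally have "?k - S s =
          (LINT z|lborel. F z * G (u z)) - (LINT z|lborel. F (z + ?v) * G (u z))"
        by simp
      also have "\<dots> = (LINT z|lborel. F z * G (u z) - F (z + ?v) * G (u z))"
        by (intro Bochner_Integration.integral_diff[symmetric] bounded_mult F int_shift; measurable)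
      also have "\<bar>\<dots>\<bar> \<le> (LINT z|lborel. B * \<bar>F (z + ?v) - F z\<bar>)"
      proof (rule integral_abs_bound_integral)
        show "\<bar>F z * G (u z) - F (z + ?v) * G (u z)\<bar> \<le> B * \<bar>F (z + ?v) - F z\<bar>" for z
        proof -
          have "\<bar>F z * G (u z) - F (z + ?v) * G (u z)\<bar> = \<bar>(F (z + ?v) - F z) * G (u z)\<bar>"
            by (simp only: left_diff_distrib abs_minus_commute)
          also have "\<dots> = \<bar>G (u z)\<bar> * \<bar>F (z + ?v) - F z\<bar>"
            by (simp only: abs_mult mult.commute)
          finally show ?thesis
            using bound[of "u z"] by (simp add: mult_right_mono)
        qed
      qed (use F int_shift in \<open>auto intro!: bounded_mult\<close>)
      also have "\<dots> = B * (LINT z|lborel. \<bar>F (z + ?v) - F z\<bar>)"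
        by simp
      also have "\<dots> \<le> B * d"
        using r[OF \<open>norm ?v < r\<close>] \<open>B \<ge> 0\<close> by (intro mult_left_mono) auto
      finally show ?thesis .
    qed
    interpret P: pair_sigma_finite "lborel :: ((real ^ 'n) \<times> (real ^ 'n)) measure"
        "torus_measure :: (real ^ 'n) measure" ..
    have int_pair: "integrable (lborel \<Otimes>\<^sub>M torus_measure) (\<lambda>(z, s). F z * G (u z + s))"
    proof -
      have "integrable (lborel \<Otimes>\<^sub>M torus_measure) (\<lambda>p :: _ \<times> (real ^ 'n). F (fst p))"
        by (rule P.Fubini_integrable) (use F in auto)
      from integrable_mult_bounded[OF this G _ bound, of "\<lambda>p. u (fst p) + snd p"]
      show ?thesis
        by (simp add: split_beta')
    qed
    \<comment> \<open>After the exchange of integrals, the inner one runs over a full period, so its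
      value does not depend on \<open>u z\<close>. The average of \<open>S\<close> is therefore
      exactly \<open>?L\<close>.\<close>
    have "(LINT s|torus_measure. S s) = (LINT z|lborel. LINT s|torus_measure. F z * G (u z + s))"
      unfolding S_def by (rule P.Fubini_integral[OF int_pair])
    also have "\<dots> = (LINT z|lborel. F z * (LINT s|torus_measure. G s))"
    proof (intro Bochner_Integration.integral_cong refl)
      fix z
      show "(LINT s|torus_measure. F z * G (u z + s)) = F z * (LINT s|torus_measure. G s)"
        using integral_torus_translate[OF G per, of "u z"] by (simp add: add.commute)
    qed
    finally have S: "(LINT s|torus_measure. S s) = ?V * ?L"
      using V(2) by simp
    have int_S: "integrable torus_measure S"
      unfolding S_def using P.integrable_snd[OF int_pair] by simp
    \<comment> \<open>The constant \<open>?k\<close> is also written as an average over the cell, so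
      the uniform bound \<open>near\<close> can be integrated.\<close>
    have "?V * (?k - ?L) = (LINT s|(torus_measure :: (real ^ 'n) measure). ?k) - (LINT s|torus_measure. S s)"
      unfolding S using V by (simp add: right_diff_distrib)
    also have "\<dots> = (LINT s|torus_measure. ?k - S s)"
      using int_S by (intro Bochner_Integration.integral_diff[symmetric]) auto
    finally have diff: "?V * (?k - ?L) = (LINT s|torus_measure. ?k - S s)" .
    have "?V * \<bar>?k - ?L\<bar> = \<bar>?V * (?k - ?L)\<bar>"
      using V(2) by (simp only: abs_mult abs_of_pos)
    also have "\<dots> = \<bar>LINT s|torus_measure. ?k - S s\<bar>"
      by (simp only: diff)
    also have "\<dots> \<le> (LINT s|torus_measure. \<bar>?k - S s\<bar>)"
      by simp
    also have "\<dots> \<le> (LINT s|(torus_measure :: (real ^ 'n) measure). B * d)"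
    proof (rule integral_mono_AE)
      show "AE s in torus_measure. \<bar>?k - S s\<bar> \<le> B * d"
        unfolding torus_measure_def using near by (subst AE_density) (auto split: split_indicator)
    qed (use int_S in auto)
    also have "\<dots> = ?V * (B * d)"
      using V by simp
    finally have "\<bar>?k - ?L\<bar> \<le> B * d"
      using V(2) by simp
    also have "\<dots> < e"
      using \<open>e > 0\<close> \<open>B \<ge> 0\<close> by (simp add: d_def field_simps)
    finally show ?thesis
      by (simp add: dist_real_def u_def)
  qed
  then show "\<forall>\<^sub>F t in at_infinity. dist (?K t) ?L < e"
    \<comment> \<open>The filter asks for a non-strict bound on \<open>norm t\<close>; 2 in place of
      1 makes it strict.\<close>
    unfolding eventually_at_infinity by (intro exI[of _ "R / r + 2"]) auto
qed

section \<open>Reduction to Borel functions\<close>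

text \<open>A mesh bound \<open>d\<close> is met by the constant gauge of balls of radius
  \<open>d / 3\<close>, whose diameter is below \<open>d\<close>. Gauge integrability in turn
  supplies Lebesgue measurability of \<open>g\<close>.\<close>

lemma riemann_integrable_imp_integrable:
  fixes h :: "'a::euclidean_space \<Rightarrow> real"
  assumes "riemann_integrable_on h (cbox a b)"
  shows "h integrable_on cbox a b"
proof -
  from assms obtain I where I: "\<And>e. e > 0 \<Longrightarrow> \<exists>d>0. \<forall>p. p tagged_division_of cbox a b \<and>
      (\<forall>(x, k)\<in>p. diameter k < d) \<longrightarrow> \<bar>(\<Sum>(x, k)\<in>p. measure lborel k * h x) - I\<bar> < e"
    unfolding riemann_integrable_on_def by blast
  have "(h has_integral I) (cbox a b)"
    unfolding has_integral
  proof (intro allI impI)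
    fix e :: real assume "e > 0"
    with I obtain d where "d > 0" and d: "\<And>p. p tagged_division_of cbox a b \<Longrightarrow>
        (\<forall>(x, k)\<in>p. diameter k < d) \<Longrightarrow> \<bar>(\<Sum>(x, k)\<in>p. measure lborel k * h x) - I\<bar> < e"
      by metis
    let ?\<gamma> = "\<lambda>x. ball x (d / 3)"
    have "norm ((\<Sum>(x, k)\<in>p. measure lborel k *\<^sub>R h x) - I) < e"
      if p: "p tagged_division_of cbox a b" "?\<gamma> fine p" for p
    proof -
      have "diameter k < d" if "(x, k) \<in> p" for x k
      proof -
        have "k \<subseteq> ball x (d / 3)"
          using p(2) that by (auto simp: fine_def)
        then have "diameter k \<le> diameter (ball x (d / 3))"
          by (intro diameter_subset) auto
        also have "\<dots> < d"
          using \<open>d > 0\<close> by simp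
        finally show ?thesis .
      qed
      then show ?thesis
        using d[OF p(1)] by auto
    qed
    then show "\<exists>\<gamma>. gauge \<gamma> \<and> (\<forall>\<D>. \<D> tagged_division_of cbox a b \<and> \<gamma> fine \<D> \<longrightarrow>
        norm ((\<Sum>(x, k)\<in>\<D>. measure lborel k *\<^sub>R h x) - I) < e)"
      using \<open>d > 0\<close> by (intro exI[of _ ?\<gamma>]) auto
  qed
  then show ?thesis
    by blast
qed

section \<open>Null sets, completion and periodic representatives\<close>

text \<open>Lebesgue measure is complete, so \<open>u\<close> inherits measurability from
  \<open>v\<close>. This serves for inner integrals, whose measurability in \<open>\<omega>\<close>
  is known only through a Borel representative.\<close>

lemma integral_lebesgue_eq_AE:
  fixes u v :: "'a::euclidean_space \<Rightarrow> real"
  assumes [measurable]: "v \<in> borel_measurable borel" and eq: "AE x in lborel. u x = v x"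
  shows "(LINT x|lebesgue. u x) = (LINT x|lborel. v x)"
proof -
  have ae: "AE x in lebesgue. u x = v x"
    using eq by (rule AE_completion)
  have v: "v \<in> borel_measurable lebesgue"
    by (rule measurable_completion) simp
  have "u \<in> borel_measurable lebesgue"
  proof (rule measurableI)
    fix A :: "real set" assume A: "A \<in> sets borel"
    show "u -` A \<inter> space lebesgue \<in> sets lebesgue"
    proof (rule completion.in_sets_AE)
      show "v -` A \<inter> space lebesgue \<in> sets lebesgue"
        using v A by (rule measurable_sets)
      show "AE x in lebesgue. x \<in> v -` A \<inter> space lebesgue \<longleftrightarrow> x \<in> u -` A \<inter> space lebesgue"
        using ae by eventually_elim auto
    qed auto
  qed simp
  then have "(LINT x|lebesgue. u x) = (LINT x|lebesgue. v x)"
    using v ae by (rule integral_cong_AE)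
  then show ?thesis
    by (simp add: integral_completion)
qed

lemma torus_integral_eq_AE:
  fixes u v :: "real ^ 'n \<Rightarrow> real"
  assumes [measurable]: "v \<in> borel_measurable borel" and eq: "AE x in lborel. u x = v x"
  shows "torus_integral u = (LINT x|torus_measure. v x)"
proof -
  have "AE x in lborel. indicat_real torus_cube x *\<^sub>R u x = indicator fund_cell x * v x"
    using eq AE_in_fund_cell_iff_torus_cube by eventually_elim (auto simp: indicator_def)
  then show ?thesis
    unfolding torus_integral_def set_lebesgue_integral_def
    by (subst integral_lebesgue_eq_AE) (auto simp: integral_torus_measure)
qed

text \<open>The shift depends on the point but takes only countably many values, so the union of the
  translated exceptional sets is still null.\<close>

lemma AE_lborel_lattice:
  fixes e :: "('n::finite \<Rightarrow> int) \<Rightarrow> 'a::euclidean_space"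
  assumes "AE z in lborel. P z"
  shows "AE z in lborel. P (z + e (k z))"
proof -
  have "AE z in lborel. \<forall>k. P (z + e k)"
    using assms by (simp add: AE_all_countable AE_lborel_translate)
  then show ?thesis
    by eventually_elim blast
qed

lemma torus_reduce_in_torus_cube: "torus_reduce x \<in> torus_cube"
  using torus_reduce_in_fund_cell[of x]
  by (auto simp: torus_cube_def fund_cell_def mem_box_cart less_imp_le)

lemma periodic_borel_representative:
  fixes g :: "real ^ 'n \<Rightarrow> real"
  assumes per: "torus_periodic g" and meas: "g \<in> borel_measurable (lebesgue_on torus_cube)"
    and bound: "\<And>x. x \<in> torus_cube \<Longrightarrow> \<bar>g x\<bar> \<le> B"
  obtains g' where "g' \<in> borel_measurable borel" "torus_periodic g'" "\<And>x. \<bar>g' x\<bar> \<le> B"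
    "AE x in lborel. g x = g' x"
proof -
  have "(\<lambda>x. indicator torus_cube x *\<^sub>R g x) \<in> borel_measurable lebesgue"
    using meas by (subst (asm) borel_measurable_restrict_space_iff) (auto simp: torus_cube_def)
  from completion_ex_borel_measurable_real[OF this]
  obtain g1 where g1: "g1 \<in> borel_measurable borel"
    and eq: "AE x in lborel. indicator torus_cube x *\<^sub>R g x = g1 x"
    by auto
  have "B \<ge> 0"
    using bound[OF torus_reduce_in_torus_cube[of 0]] by linarith
  \<comment> \<open>Composing with the reduction makes the representative periodic everywhere, and
    truncation makes it bounded everywhere; almost everywhere neither alters its agreement with
    \<open>g\<close>.\<close>
  let ?g = "\<lambda>x. max (- B) (min B (g1 (torus_reduce x)))"
  show ?thesis
  proof
    show "?g \<in> borel_measurable borel"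
      using g1 by measurable
    show "torus_periodic ?g"
      by (rule torus_periodic_comp_reduce)
    show "\<bar>?g x\<bar> \<le> B" for x
      using \<open>B \<ge> 0\<close> by auto
    show "AE x in lborel. g x = ?g x"
      using AE_lborel_lattice[OF eq, of lattice_point "\<lambda>x i. - \<lfloor>x $ i / (2 * pi)\<rfloor>"]
    proof eventually_elim
      case (elim x)
      have "g x = g (torus_reduce x)"
        using per by (simp add: torus_periodic_reduce)
      also have "\<dots> = g1 (torus_reduce x)"
        using elim torus_reduce_in_torus_cube[of x] by (simp add: torus_reduce_def)
      finally show ?case
        using bound[OF torus_reduce_in_torus_cube[of x]] per by (auto simp: torus_periodic_reduce)
    qed
  qed
qed

section \<open>The limit of the correlation function\<close>

theorem theorem1:
  fixes f :: "real ^ 'n \<Rightarrow> real ^ 'n \<Rightarrow> real"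
    and g :: "real ^ 'n \<Rightarrow> real"
  assumes "\<And>\<omega>. torus_periodic (f \<omega>)"
    and "set_integrable lebesgue (UNIV \<times> torus_cube) (\<lambda>(\<omega>, x). f \<omega> x)"
    and "torus_periodic g"
    and "riemann_integrable_on g torus_cube"
  shows "(correlation f g \<longlongrightarrow> phase_mean f * torus_average g) at_top \<and>
         (correlation f g \<longlongrightarrow> phase_mean f * torus_average g) at_bot"
proof -
  from assms(4) obtain B where B: "\<And>x. x \<in> torus_cube \<Longrightarrow> \<bar>g x\<bar> \<le> B"
    by (auto simp: riemann_integrable_on_def bounded_iff)
  have "g integrable_on torus_cube"
    using assms(4) riemann_integrable_imp_integrable unfolding torus_cube_def by blast
  then obtain g' where g' [measurable]: "g' \<in> borel_measurable borel"
    and per_g': "torus_periodic g'" and bound: "\<And>x. \<bar>g' x\<bar> \<le> B"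
    and gg': "AE x in lborel. g x = g' x"
    using periodic_borel_representative[OF assms(3) integrable_imp_measurable B] by metis
  let ?F0 = "\<lambda>z. indicat_real (UNIV \<times> torus_cube) z *\<^sub>R (case z of (\<omega>, x) \<Rightarrow> f \<omega> x)"
  have F0: "integrable lebesgue ?F0"
    using assms(2) by (simp add: set_integrable_def)
  from completion_ex_borel_measurable_real[OF borel_measurable_integrable[OF F0]]
  obtain f1 :: "(real ^ 'n) \<times> (real ^ 'n) \<Rightarrow> real" where f1 [measurable]: "f1 \<in> borel_measurable borel"
    and eq: "AE z in lborel. ?F0 z = f1 z"
    by auto
  have "integrable lebesgue f1"
    using F0 by (rule integrable_cong_AE_imp)
       (use eq in \<open>auto simp: AE_completion eq_commute intro: measurable_completion\<close>)
  then have f1_int: "integrable lborel f1"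
    by (simp add: integrable_completion)
  define f' where "f' \<omega> x = f1 (\<omega>, torus_reduce x)" for \<omega> x
  have per_f': "torus_periodic (f' \<omega>)" for \<omega>
    unfolding f'_def by (rule torus_periodic_comp_reduce)
  have pair [measurable]: "f1 \<in> borel_measurable (borel \<Otimes>\<^sub>M borel)"
    using f1 by (simp add: borel_prod)
  have f'_meas [measurable]: "case_prod f' \<in> borel_measurable (borel \<Otimes>\<^sub>M borel)"
    unfolding f'_def by measurable
  have "AE z in lborel. f (fst z) (snd z) = f' (fst z) (snd z)"
    \<comment> \<open>Only the second component is reduced: agreement on the cube spreads to all of
      space by periodicity in \<open>x\<close>.\<close>
    using AE_lborel_lattice[OF eq, of "\<lambda>k. (0, lattice_point k)"
      "\<lambda>z i. - \<lfloor>snd z $ i / (2 * pi)\<rfloor>"]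
  proof eventually_elim
    case (elim z)
    have "f (fst z) (snd z) = f (fst z) (torus_reduce (snd z))"
      using assms(1) by (simp add: torus_periodic_reduce)
    also have "\<dots> = f' (fst z) (snd z)"
      using elim torus_reduce_in_torus_cube[of "snd z"]
      by (cases z) (simp add: torus_reduce_def f'_def)
    finally show ?case .
  qed
  then have "AE z in lborel \<Otimes>\<^sub>M lborel. f (fst z) (snd z) = f' (fst z) (snd z)"
    unfolding lborel_prod .
  from lborel_pair.AE_pair[OF this]
  have ff': "AE \<omega> in lborel. AE x in lborel. f \<omega> x = f' \<omega> x"
    by simp
  \<comment> \<open>\<open>f1\<close> may stand here in place of \<open>f'\<close>, since the
    reduction is the identity on the cell.\<close>
  define F where "F = (\<lambda>z :: (real ^ 'n) \<times> (real ^ 'n). indicator (UNIV \<times> fund_cell) z * f1 z)"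
  have F_int: "integrable lborel F"
    unfolding F_def using integrable_mult_indicator[OF _ f1_int, of "UNIV \<times> fund_cell"]
    by (simp add: borel_Times)
  have F_eq: "F (\<omega>, x) = indicator fund_cell x * f' \<omega> x" for \<omega> x
    by (auto simp: F_def f'_def torus_reduce_id split: split_indicator)
  have [measurable]: "f' \<omega> \<in> borel_measurable borel" for \<omega>
    unfolding f'_def by measurable
  have mean_f: "phase_mean f = (LINT z|lborel. F z)"
  proof -
    have "phase_mean f = (LINT \<omega>|lborel. LINT x|torus_measure. f' \<omega> x)"
      unfolding phase_mean_def
    proof (rule integral_lebesgue_eq_AE)
      show "AE \<omega> in lborel. torus_integral (f \<omega>) = (LINT x|torus_measure. f' \<omega> x)"
        using ff' by eventually_elim (auto intro: torus_integral_eq_AE)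
    qed measurable
    also have "\<dots> = (LINT \<omega>|lborel. LINT x|lborel. F (\<omega>, x))"
      by (simp add: integral_torus_measure F_eq)
    also have "\<dots> = (LINT z|lborel. F z)"
      using lborel_pair.integral_fst'[of F] F_int by (simp add: lborel_prod)
    finally show ?thesis .
  qed
  have mean_g: "torus_average g = (LINT x|torus_measure. g' x) / (2 * pi) ^ CARD('n)"
    unfolding torus_average_def using torus_integral_eq_AE[OF g' gg'] by simp
  have corr: "correlation f g t = (LINT z|lborel. F z * g' (snd z + t *\<^sub>R fst z))" for t
  proof -
    have shift: "(LINT x|torus_measure. f' \<omega> (x - t *\<^sub>R \<omega>) * g' x) =
        (LINT x|torus_measure. f' \<omega> x * g' (x + t *\<^sub>R \<omega>))" for \<omega>
    proof -
      \<comment> \<open>Translating this product by \<open>- (t *\<^sub>R \<omega>)\<close> yields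
        the integrand of the correlation, so the time shift passes from \<open>f'\<close> to
        \<open>g'\<close>.\<close>
      have "torus_periodic (\<lambda>x. f' \<omega> x * g' (x + t *\<^sub>R \<omega>))"
        using per_f' per_g' by (simp add: torus_periodic_def add.assoc add.commute[of "axis _ _"])
           (metis add.assoc)
      from integral_torus_translate[OF _ this, of "- (t *\<^sub>R \<omega>)"] show ?thesis
        by simp
    qed
    have "correlation f g t = (LINT \<omega>|lborel. LINT x|torus_measure. f' \<omega> x * g' (x + t *\<^sub>R \<omega>))"
      unfolding correlation_def
    proof (rule integral_lebesgue_eq_AE)
      show "AE \<omega> in lborel. torus_integral (\<lambda>x. f \<omega> (x - t *\<^sub>R \<omega>) * g x) =
          (LINT x|torus_measure. f' \<omega> x * g' (x + t *\<^sub>R \<omega>))"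
        using ff'
      proof eventually_elim
        case (elim \<omega>)
        have "AE x in lborel. f \<omega> (x - t *\<^sub>R \<omega>) * g x = f' \<omega> (x - t *\<^sub>R \<omega>) * g' x"
          using AE_lborel_translate[OF elim, of "- (t *\<^sub>R \<omega>)"] gg' by eventually_elim simp
        then have "torus_integral (\<lambda>x. f \<omega> (x - t *\<^sub>R \<omega>) * g x) =
            (LINT x|torus_measure. f' \<omega> (x - t *\<^sub>R \<omega>) * g' x)"
          by (intro torus_integral_eq_AE) measurable
        then show ?case
          by (simp add: shift)
      qed
    qed measurable
    also have "\<dots> = (LINT \<omega>|lborel. LINT x|lborel. F (\<omega>, x) * g' (x + t *\<^sub>R \<omega>))"
      by (simp add: integral_torus_measure F_eq mult.assoc)
    also have "\<dots> = (LINT z|lborel. F z * g' (snd z + t *\<^sub>R fst z))"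
    proof -
      have "integrable lborel (\<lambda>z. F z * g' (snd z + t *\<^sub>R fst z))"
        by (rule integrable_mult_bounded[OF F_int g' _ bound])
           (simp, intro borel_measurable_continuous_onI continuous_intros)
      then show ?thesis
        using lborel_pair.integral_fst'[of "\<lambda>z. F z * g' (snd z + t *\<^sub>R fst z)"]
        by (simp add: lborel_prod)
    qed
    finally show ?thesis .
  qed
  \<comment> \<open>Both \<open>at_top\<close> and \<open>at_bot\<close> refine
    \<open>at_infinity\<close>, so one limit gives the two claims.\<close>
  have "(correlation f g \<longlongrightarrow> phase_mean f * torus_average g) at_infinity"
    using tendsto_product_translate[OF F_int g' per_g' bound]
    by (simp add: mean_f mean_g ext[of "correlation f g", OF corr])
  then show ?thesis
    using filterlim_mono[OF _ order_refl at_top_le_at_infinity]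
      filterlim_mono[OF _ order_refl at_bot_le_at_infinity] by blast
qed

end
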